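(* Let $\Sigma=(X,X_0,S,U,\to,Y,h)$ be a total NFTS and $\Sigma_V$ its verification system with state set $X_V$. Then $\Sigma$ is current-state opaque if and only if $q^1\not\subseteq S$ for every $(q^1,q^2)\in X_V$.
   Context: An NFTS is a tuple $\Sigma=(X,X_0,S,U,\to,Y,h)$ with $X$ a finite set of states, $X_0\subseteq X$ initial states, $S\subseteq X$ secret states, $U$ a finite set of inputs, $\to\subseteq X\times U\times X$ the transition relation (write $x\xrightarrow{u}x'$), $Y$ a set of outputs and $h:X\to Y$. It is total if for every $x\in X$, $u\in U$ there is $x'$ with $x\xrightarrow{u}x'$. For $\alpha=\alpha(0)\cdots\alpha(|\alpha|-1)\in U^*$ (finite sequences, including empty), a run over $\alpha$ is a nonempty sequence $x_0\dots x_k$ with $k\le|\alpha|$, $x_0\in X_0$, $(x_j,\alpha(j),x_{j+1})\in\to$ for $j<k$. $\Sigma$ is current-state opaque if for every $\alpha\in U^*$ and every run $x_0\dots x_{|\alpha|}$ over $\alpha$ with $x_{|\alpha|}\in S$ there is a run $x_0'\dots x'_{|\alpha|}$ over $\alpha$ with $x'_{|\alpha|}\notin S$ and $h(x_j)=h(x_j')$ for all $j$. For $y\in Y$ let $X_y=\{x\mid h(x)=y\}$, $X_{0,y}=X_0\cap X_y$; for $q\subseteq X$, $u\in U$, $\mathrm{suc}(q,u)=\{x\mid\exists x'\in q,(x',u,x)\in\to\}$, $\mathrm{post}(q,u)=\{x\mid\exists x'\in q,(x,u,x')\in\to\}$. Let $\epsilon\notin U$. The verification system $\Sigma_V$ has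 input set $U_V=(U\times\{\epsilon\})\cup(\{\epsilon\}\times U)$, initial states $X_{V,0}=\{(X_{0,y_1},X_{y_2})\mid y_1,y_2\in Y,\ X_{0,y_1}\neq\emptyset,\ X_{y_2}\neq\emptyset\}$, transitions $(q_1,q_2)\xrightarrow{(u,\epsilon)}_V(q_1',q_2)$ iff $q_1'=\mathrm{suc}(q_1,u)\cap X_y\neq\emptyset$ for some $y\in Y$, and $(q_1,q_2)\xrightarrow{(\epsilon,u)}_V(q_1,q_2')$ iff $q_2'=\mathrm{post}(q_2,u)\cap X_y\neq\emptyset$ for some $y\in Y$; its state set $X_V$ is the set of pairs reachable from $X_{V,0}$ by finitely many transitions. *)

theory Defs
  imports Main
begin

record ('x, 'u) trans_sys =
  states :: "'x set"
  init :: "'x set"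
  inputs :: "'u set"
  trans_rel :: "('x \<times> 'u \<times> 'x) set"

record ('x, 'u, 'y) nfts = "('x, 'u) trans_sys" +
  secret :: "'x set"
  outputs :: "'y set"
  out :: "'x \<Rightarrow> 'y"

definition is_nfts :: "('x, 'u, 'y) nfts \<Rightarrow> bool" where
  "is_nfts \<Sigma> \<longleftrightarrow>
     finite (states \<Sigma>) \<and> init \<Sigma> \<subseteq> states \<Sigma> \<and> secret \<Sigma> \<subseteq> states \<Sigma> \<and>
     finite (inputs \<Sigma>) \<and> trans_rel \<Sigma> \<subseteq> states \<Sigma> \<times> inputs \<Sigma> \<times> states \<Sigma> \<and>
     out \<Sigma> ` states \<Sigma> \<subseteq> outputs \<Sigma>"

definition is_total :: "('x, 'u, 'y) nfts \<Rightarrow> bool" where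
  "is_total \<Sigma> \<longleftrightarrow>
     (\<forall>x\<in>states \<Sigma>. \<forall>u\<in>inputs \<Sigma>. \<exists>x'\<in>states \<Sigma>. (x, u, x') \<in> trans_rel \<Sigma>)"

text \<open>A run over \<open>\<alpha>\<close> may be shorter than \<open>\<alpha>\<close>: the list \<open>x\<^sub>0 \<dots> x\<^sub>k\<close> has length \<open>k + 1\<close>,
  where \<open>k \<le> length \<alpha>\<close>.\<close>

definition is_run :: "('x, 'u, 'y) nfts \<Rightarrow> 'u list \<Rightarrow> 'x list \<Rightarrow> bool" where
  "is_run \<Sigma> \<alpha> xs \<longleftrightarrow>
     xs \<noteq> [] \<and> length xs \<le> length \<alpha> + 1 \<and> xs ! 0 \<in> init \<Sigma> \<and>
     (\<forall>j. j + 1 < length xs \<longrightarrow> (xs ! j, \<alpha> ! j, xs ! (j + 1)) \<in> trans_rel \<Sigma>)"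

definition current_state_opaque :: "('x, 'u, 'y) nfts \<Rightarrow> bool" where
  "current_state_opaque \<Sigma> \<longleftrightarrow>
     (\<forall>\<alpha>\<in>lists (inputs \<Sigma>). \<forall>xs.
        is_run \<Sigma> \<alpha> xs \<and> length xs = length \<alpha> + 1 \<and> xs ! length \<alpha> \<in> secret \<Sigma> \<longrightarrow>
        (\<exists>xs'. is_run \<Sigma> \<alpha> xs' \<and> length xs' = length \<alpha> + 1 \<and>
               xs' ! length \<alpha> \<notin> secret \<Sigma> \<and>
               (\<forall>j\<le>length \<alpha>. out \<Sigma> (xs ! j) = out \<Sigma> (xs' ! j))))"

definition states_out :: "('x, 'u, 'y) nfts \<Rightarrow> 'y \<Rightarrow> 'x set" where
  "states_out \<Sigma> y = {x \<in> states \<Sigma>. out \<Sigma> x = y}"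

definition init_out :: "('x, 'u, 'y) nfts \<Rightarrow> 'y \<Rightarrow> 'x set" where
  "init_out \<Sigma> y = init \<Sigma> \<inter> states_out \<Sigma> y"

definition suc :: "('x, 'u, 'y) nfts \<Rightarrow> 'x set \<Rightarrow> 'u \<Rightarrow> 'x set" where
  "suc \<Sigma> q u = {x \<in> states \<Sigma>. \<exists>x'\<in>q. (x', u, x) \<in> trans_rel \<Sigma>}"

text \<open>Despite its name, \<open>post\<close> collects predecessors: it is used to run the system backwards.\<close>

definition post :: "('x, 'u, 'y) nfts \<Rightarrow> 'x set \<Rightarrow> 'u \<Rightarrow> 'x set" where
  "post \<Sigma> q u = {x \<in> states \<Sigma>. \<exists>x'\<in>q. (x, u, x') \<in> trans_rel \<Sigma>}"

text \<open>Inputs of the verification system are pairs over \<open>U \<union> {\<epsilon>}\<close> with \<open>\<epsilon> \<notin> U\<close>; this is rendered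
  by the option type, with \<open>None\<close> for \<open>\<epsilon>\<close> and \<open>Some u\<close> for \<open>u\<close>.\<close>

definition ver_inputs :: "('x, 'u, 'y) nfts \<Rightarrow> ('u option \<times> 'u option) set" where
  "ver_inputs \<Sigma> = (Some ` inputs \<Sigma>) \<times> {None} \<union> {None} \<times> (Some ` inputs \<Sigma>)"

definition ver_init :: "('x, 'u, 'y) nfts \<Rightarrow> ('x set \<times> 'x set) set" where
  "ver_init \<Sigma> = {(init_out \<Sigma> y1, states_out \<Sigma> y2) | y1 y2.
     y1 \<in> outputs \<Sigma> \<and> y2 \<in> outputs \<Sigma> \<and> init_out \<Sigma> y1 \<noteq> {} \<and> states_out \<Sigma> y2 \<noteq> {}}"

inductive_set ver_step ::
  "('x, 'u, 'y) nfts \<Rightarrow>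
     (('x set \<times> 'x set) \<times> ('u option \<times> 'u option) \<times> ('x set \<times> 'x set)) set"
  for \<Sigma> :: "('x, 'u, 'y) nfts"
where
  left: "\<lbrakk>u \<in> inputs \<Sigma>; y \<in> outputs \<Sigma>; q1' = suc \<Sigma> q1 u \<inter> states_out \<Sigma> y; q1' \<noteq> {}\<rbrakk>
    \<Longrightarrow> ((q1, q2), (Some u, None), (q1', q2)) \<in> ver_step \<Sigma>"
| right: "\<lbrakk>u \<in> inputs \<Sigma>; y \<in> outputs \<Sigma>; q2' = post \<Sigma> q2 u \<inter> states_out \<Sigma> y; q2' \<noteq> {}\<rbrakk>
    \<Longrightarrow> ((q1, q2), (None, Some u), (q1, q2')) \<in> ver_step \<Sigma>"

definition ver_states :: "('x, 'u, 'y) nfts \<Rightarrow> ('x set \<times> 'x set) set" where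
  "ver_states \<Sigma> = {(p, p'). \<exists>w\<in>ver_inputs \<Sigma>. (p, w, p') \<in> ver_step \<Sigma>}\<^sup>* `` ver_init \<Sigma>"

definition verification_system ::
  "('x, 'u, 'y) nfts \<Rightarrow> ('x set \<times> 'x set, 'u option \<times> 'u option) trans_sys" where
  "verification_system \<Sigma> =
     \<lparr>states = ver_states \<Sigma>,
      init = ver_init \<Sigma>,
      inputs = ver_inputs \<Sigma>,
      trans_rel = ver_step \<Sigma> \<inter> ver_states \<Sigma> \<times> ver_inputs \<Sigma> \<times> ver_states \<Sigma>\<rparr>"

end

theory Submission
  imports Defs
begin

text \<open>The first components of the states of the verification system are exactly the nonempty
  current-state estimates, i.e. the sets of all states in which the runs over some input word with
  some prescribed output word can end. The second component never constrains the first, so it can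
  be left at its initial value. Opacity says that no nonempty estimate consists of secret states
  only.\<close>

definition full_run :: "('x, 'u, 'y) nfts \<Rightarrow> 'u list \<Rightarrow> 'x list \<Rightarrow> bool" where
  "full_run \<Sigma> \<alpha> xs \<longleftrightarrow> is_run \<Sigma> \<alpha> xs \<and> length xs = length \<alpha> + 1"

text \<open>The length of \<open>ys\<close> is left free: unless it is
  \<open>length \<alpha> + 1\<close>, the set is empty. Hence nonemptiness has to be recorded
  separately later on.\<close>

definition estimate :: "('x, 'u, 'y) nfts \<Rightarrow> 'u list \<Rightarrow> 'y list \<Rightarrow> 'x set" where
  "estimate \<Sigma> \<alpha> ys = {last xs | xs. full_run \<Sigma> \<alpha> xs \<and> map (out \<Sigma>) xs = ys}"

lemma full_run_Nil: "full_run \<Sigma> [] xs \<longleftrightarrow> (\<exists>x\<in>init \<Sigma>. xs = [x])"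
  by (auto simp: full_run_def is_run_def length_Suc_conv)

lemma full_run_snoc:
  "full_run \<Sigma> (\<alpha> @ [u]) (xs @ [x]) \<longleftrightarrow> full_run \<Sigma> \<alpha> xs \<and> (last xs, u, x) \<in> trans_rel \<Sigma>"
proof (cases "length xs = length \<alpha> + 1")
  case True
  then have "xs \<noteq> []" by auto
  \<comment> \<open>The last index of \<open>xs\<close> is \<open>length \<alpha>\<close>, so among
    the transition conditions for \<open>xs @ [x]\<close> the one at
    \<open>j = length \<alpha>\<close> is the new step, and all earlier ones concern
    \<open>xs\<close> only.\<close>
  with True show ?thesis
    by (auto simp: full_run_def is_run_def nth_append last_conv_nth less_Suc_eq all_conj_distrib
        imp_conjR)
next
  case False
  then show ?thesis by (simp add: full_run_def)
qed

lemma full_run_snocE: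
  assumes "full_run \<Sigma> (\<alpha> @ [u]) zs"
  obtains xs x where "zs = xs @ [x]" "full_run \<Sigma> \<alpha> xs" "(last xs, u, x) \<in> trans_rel \<Sigma>"
proof (cases zs rule: rev_cases)
  case Nil
  with assms show ?thesis by (simp add: full_run_def)
next
  case (snoc xs x)
  with assms that show ?thesis by (simp add: full_run_snoc)
qed

lemma estimate_Nil:
  assumes "is_nfts \<Sigma>"
  shows "estimate \<Sigma> [] [y] = init_out \<Sigma> y"
  using assms
  by (auto simp: estimate_def full_run_Nil init_out_def states_out_def is_nfts_def
      intro!: exI[of _ "[_]"])

text \<open>Splitting off or appending the final state of a full run turns the estimate into the
  update of the first component in \<open>ver_step.left\<close>. This recursion links words to paths
  of the verification system.\<close>

lemma estimate_snoc:
  assumes "is_nfts \<Sigma>"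
  shows "estimate \<Sigma> (\<alpha> @ [u]) (ys @ [y]) = suc \<Sigma> (estimate \<Sigma> \<alpha> ys) u \<inter> states_out \<Sigma> y"
    (is "?L = ?R")
proof
  show "?L \<subseteq> ?R"
  proof
    fix x assume "x \<in> ?L"
    then obtain zs where zs: "full_run \<Sigma> (\<alpha> @ [u]) zs" "map (out \<Sigma>) zs = ys @ [y]" "last zs = x"
      by (auto simp: estimate_def)
    from zs(1) obtain xs x' where "zs = xs @ [x']" "full_run \<Sigma> \<alpha> xs"
      "(last xs, u, x') \<in> trans_rel \<Sigma>"
      by (rule full_run_snocE)
    with zs assms show "x \<in> ?R"
      by (auto simp: estimate_def suc_def states_out_def is_nfts_def)
  qed
  show "?R \<subseteq> ?L"
  proof
    fix x assume "x \<in> ?R"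
    then obtain xs where "full_run \<Sigma> \<alpha> xs" "map (out \<Sigma>) xs = ys"
      "(last xs, u, x) \<in> trans_rel \<Sigma>" "out \<Sigma> x = y"
      by (auto simp: estimate_def suc_def states_out_def)
    then have "full_run \<Sigma> (\<alpha> @ [u]) (xs @ [x])" "map (out \<Sigma>) (xs @ [x]) = ys @ [y]"
      by (auto simp: full_run_snoc)
    then show "x \<in> ?L"
      unfolding estimate_def by (metis (mono_tags, lifting) last_snoc mem_Collect_eq)
  qed
qed

lemma ver_states_initI: "p \<in> ver_init \<Sigma> \<Longrightarrow> p \<in> ver_states \<Sigma>"
  by (auto simp: ver_states_def)

lemma ver_states_stepI:
  "\<lbrakk>p \<in> ver_states \<Sigma>; w \<in> ver_inputs \<Sigma>; (p, w, p') \<in> ver_step \<Sigma>\<rbrakk> \<Longrightarrow> p' \<in> ver_states \<Sigma>"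
  unfolding ver_states_def by (auto intro: rtrancl_into_rtrancl)

lemma ver_states_induct [consumes 1, case_names init step]:
  assumes "p \<in> ver_states \<Sigma>"
    and "\<And>p. p \<in> ver_init \<Sigma> \<Longrightarrow> P p"
    and "\<And>p w p'. \<lbrakk>P p; (p, w, p') \<in> ver_step \<Sigma>\<rbrakk> \<Longrightarrow> P p'"
  shows "P p"
proof -
  from assms(1) obtain p0 where "p0 \<in> ver_init \<Sigma>"
    "(p0, p) \<in> {(p, p'). \<exists>w\<in>ver_inputs \<Sigma>. (p, w, p') \<in> ver_step \<Sigma>}\<^sup>*"
    by (auto simp: ver_states_def)
  from this(2,1) show ?thesis
    by (induction rule: rtrancl_induct) (use assms(2,3) in blast)+
qed

text \<open>Along a path from an initial state, a \<open>left\<close> transition appends one input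
  and one output to the words describing the first component, and a \<open>right\<close> transition
  leaves both words alone. Nonemptiness is kept so that a run with outputs \<open>ys\<close> can be
  extracted afterwards.\<close>

lemma ver_states_estimate:
  assumes "is_nfts \<Sigma>" "p \<in> ver_states \<Sigma>"
  shows "\<exists>\<alpha>\<in>lists (inputs \<Sigma>). \<exists>ys. fst p = estimate \<Sigma> \<alpha> ys \<and> fst p \<noteq> {}"
  using assms(2)
proof (induction rule: ver_states_induct)
  case (init p)
  then obtain y where "fst p = init_out \<Sigma> y" "fst p \<noteq> {}"
    unfolding ver_init_def by fastforce
  then show ?case
    using estimate_Nil[OF assms(1)] by (metis lists.Nil)
next
  case (step p w p')
  obtain q1 q2 w1 w2 q1' q2' where pw: "p = (q1, q2)" "w = (w1, w2)" "p' = (q1', q2')"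
    by (metis surj_pair)
  from step(1) obtain \<alpha> ys where \<alpha>: "\<alpha> \<in> lists (inputs \<Sigma>)"
    and q1: "q1 = estimate \<Sigma> \<alpha> ys" "q1 \<noteq> {}"
    by (auto simp: pw)
  from step(2)[unfolded pw] show ?case
  proof cases
    case (left u y)
    with \<alpha> q1 estimate_snoc[OF assms(1), of \<alpha> u ys y] show ?thesis
      by (intro bexI[of _ "\<alpha> @ [u]"] exI[of _ "ys @ [y]"]) (auto simp: pw)
  next
    case right
    with \<alpha> q1 show ?thesis by (auto simp: pw)
  qed
qed

text \<open>The path follows \<open>\<alpha>\<close> by \<open>left\<close> transitions only. Each
  is permitted because the prefixes of \<open>xs\<close> keep all estimates along the way
  nonempty.\<close>

lemma estimate_ver_states:
  assumes "is_nfts \<Sigma>" "\<alpha> \<in> lists (inputs \<Sigma>)" "full_run \<Sigma> \<alpha> xs"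
  shows "\<exists>q2. (estimate \<Sigma> \<alpha> (map (out \<Sigma>) xs), q2) \<in> ver_states \<Sigma>"
  using assms(2,3)
proof (induction \<alpha> arbitrary: xs rule: rev_induct)
  case Nil
  then obtain x where x: "x \<in> init \<Sigma>" "xs = [x]"
    by (auto simp: full_run_Nil)
  let ?y = "out \<Sigma> x"
  from x assms(1) have "x \<in> init_out \<Sigma> ?y" "x \<in> states_out \<Sigma> ?y" "?y \<in> outputs \<Sigma>"
    by (auto simp: is_nfts_def init_out_def states_out_def image_subset_iff)
  \<comment> \<open>Both components use the output of \<open>x\<close>, so \<open>x\<close> itself
    shows that both are nonempty.\<close>
  then have "(init_out \<Sigma> ?y, states_out \<Sigma> ?y) \<in> ver_init \<Sigma>"
    unfolding ver_init_def by blast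
  then show ?case
    using x(2) estimate_Nil[OF assms(1)] by (auto intro: ver_states_initI)
next
  case (snoc u \<alpha>)
  from snoc.prems(2) obtain xs' x where xs: "xs = xs' @ [x]" "full_run \<Sigma> \<alpha> xs'"
    "(last xs', u, x) \<in> trans_rel \<Sigma>"
    by (rule full_run_snocE)
  let ?q = "estimate \<Sigma> \<alpha> (map (out \<Sigma>) xs')"
  let ?q' = "estimate \<Sigma> (\<alpha> @ [u]) (map (out \<Sigma>) xs)"
  from snoc xs obtain q2 where q2: "(?q, q2) \<in> ver_states \<Sigma>" by auto
  have u: "u \<in> inputs \<Sigma>" using snoc.prems by auto
  have y: "out \<Sigma> x \<in> outputs \<Sigma>" using assms(1) xs(3) by (auto simp: is_nfts_def image_subset_iff)
  \<comment> \<open>The run \<open>xs\<close> is its own witness: \<open>last xs\<close> lies in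
    \<open>?q'\<close>.\<close>
  have "?q' \<noteq> {}" using snoc.prems by (auto simp: estimate_def)
  moreover have "?q' = suc \<Sigma> ?q u \<inter> states_out \<Sigma> (out \<Sigma> x)"
    using estimate_snoc[OF assms(1)] by (simp add: xs(1))
  ultimately have "((?q, q2), (Some u, None), (?q', q2)) \<in> ver_step \<Sigma>"
    using u y by (intro ver_step.left)
  moreover have "(Some u, None) \<in> ver_inputs \<Sigma>" using u by (simp add: ver_inputs_def)
  ultimately show ?case using q2 ver_states_stepI by blast
qed

lemma full_run_last: "full_run \<Sigma> \<alpha> xs \<Longrightarrow> last xs = xs ! length \<alpha>"
  by (auto simp: full_run_def is_run_def last_conv_nth)

lemma full_run_outputs_eq_iff:
  assumes "full_run \<Sigma> \<alpha> xs" "full_run \<Sigma> \<alpha> xs'"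
  shows "map (out \<Sigma>) xs' = map (out \<Sigma>) xs \<longleftrightarrow>
    (\<forall>j\<le>length \<alpha>. out \<Sigma> (xs ! j) = out \<Sigma> (xs' ! j))"
  using assms by (auto simp: full_run_def list_eq_iff_nth_eq less_Suc_eq_le)

text \<open>The runs that an observer cannot distinguish from \<open>xs\<close> end exactly in the
  states of its estimate, so a nonsecret alternative to \<open>xs\<close> amounts to a nonsecret
  state there.\<close>

lemma current_state_opaque_iff_estimate:
  "current_state_opaque \<Sigma> \<longleftrightarrow>
    (\<forall>\<alpha>\<in>lists (inputs \<Sigma>). \<forall>xs. full_run \<Sigma> \<alpha> xs \<longrightarrow>
      \<not> estimate \<Sigma> \<alpha> (map (out \<Sigma>) xs) \<subseteq> secret \<Sigma>)"
proof -
  have "current_state_opaque \<Sigma> \<longleftrightarrow>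
    (\<forall>\<alpha>\<in>lists (inputs \<Sigma>). \<forall>xs. full_run \<Sigma> \<alpha> xs \<and> last xs \<in> secret \<Sigma> \<longrightarrow>
      (\<exists>xs'. full_run \<Sigma> \<alpha> xs' \<and> last xs' \<notin> secret \<Sigma> \<and> map (out \<Sigma>) xs' = map (out \<Sigma>) xs))"
    unfolding current_state_opaque_def
    by (smt (verit) full_run_def full_run_last full_run_outputs_eq_iff)
  also have "\<dots> \<longleftrightarrow> (\<forall>\<alpha>\<in>lists (inputs \<Sigma>). \<forall>xs. full_run \<Sigma> \<alpha> xs \<longrightarrow>
      (\<exists>xs'. full_run \<Sigma> \<alpha> xs' \<and> last xs' \<notin> secret \<Sigma> \<and> map (out \<Sigma>) xs' = map (out \<Sigma>) xs))"
    by blast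
  finally show ?thesis
    unfolding estimate_def by blast
qed

theorem theorem5p2:
  fixes \<Sigma> :: "('x, 'u, 'y) nfts"
  assumes "is_nfts \<Sigma>" and "is_total \<Sigma>"
  shows "current_state_opaque \<Sigma> \<longleftrightarrow>
    (\<forall>(q1, q2) \<in> states (verification_system \<Sigma>). \<not> q1 \<subseteq> secret \<Sigma>)"
proof -
  have "\<not> q1 \<subseteq> secret \<Sigma>"
    if opaque: "current_state_opaque \<Sigma>" and q: "(q1, q2) \<in> ver_states \<Sigma>" for q1 q2
  proof -
    from ver_states_estimate[OF assms(1) q] obtain \<alpha> ys where
      \<alpha>: "\<alpha> \<in> lists (inputs \<Sigma>)" "q1 = estimate \<Sigma> \<alpha> ys" "q1 \<noteq> {}"
      by auto
    \<comment> \<open>Any element of the nonempty \<open>q1\<close> is the end of such a run, which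
      identifies \<open>ys\<close> as an output word that actually occurs.\<close>
    then obtain xs where "full_run \<Sigma> \<alpha> xs" "ys = map (out \<Sigma>) xs"
      by (auto simp: estimate_def)
    with \<alpha> opaque show ?thesis
      by (simp add: current_state_opaque_iff_estimate)
  qed
  moreover have "current_state_opaque \<Sigma>"
    if "\<forall>(q1, q2) \<in> ver_states \<Sigma>. \<not> q1 \<subseteq> secret \<Sigma>"
    unfolding current_state_opaque_iff_estimate
    using estimate_ver_states[OF assms(1)] that by blast
  ultimately show ?thesis
    by (auto simp: verification_system_def)
qed

end
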